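(* Let $G$ be a finite abelian group of odd order $v$ and let $J$ be a subgroup of $G$ of order $t$. Let $\lambda,n,k$ be positive integers with $n\ge k$, $v=\frac{2nk}{\lambda}+t$ and $t\mid v$. Then there exists a ${}^\lambda\mathrm{NH}_t(n;k)$ over $G$ relative to $J$.
   Context: Groups are written additively. An $m\times n$ partially filled (p.f.) array over $G$ is an $m\times n$ matrix each of whose cells is empty or contains an element of $G$. For a subgroup $J$ of order $t$, a ${}^\lambda\mathrm{NH}_t(m,n;h,k)$ over $G$ relative to $J$ is an $m\times n$ p.f. array $A$ over $G$ such that: (a) each row contains exactly $h$ filled cells and each column exactly $k$ filled cells; (b) the multiset obtained by taking, for every filled cell with entry $x$, both $x$ and $-x$ (with multiplicity), is exactly the multiset containing each element of $G\setminus J$ exactly $\lambda$ times; (c) each row sum (left to right) and each column sum (top to bottom) is nonzero. ${}^\lambda\mathrm{NH}_t(n;k)$ denotes ${}^\lambda\mathrm{NH}_t(n,n;k,k)$. *)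

theory Defs
  imports "HOL-Algebra.Coset" "HOL-Library.Multiset" Complex_Main
begin

text \<open>
  Groups are taken from HOL-Algebra and hence appear multiplicatively: the additive notions
  $0$, $-x$ and $x + y$ of the mathematical text are the unit, the inverse and the product of
  the group \<open>G\<close>.
\<close>

text \<open>
  In a partially filled \<open>m \<times> n\<close> array, \<open>None\<close> marks an empty cell. Rows are indexed by
  \<open>{..<m}\<close> and columns by \<open>{..<n}\<close>; values outside this range carry no meaning.
\<close>

type_synonym 'a pf_array = "nat \<Rightarrow> nat \<Rightarrow> 'a option"

definition pf_array_over :: "('a, 'b) monoid_scheme \<Rightarrow> nat \<Rightarrow> nat \<Rightarrow> 'a pf_array \<Rightarrow> bool" where
  "pf_array_over G m n A \<longleftrightarrow>
     (\<forall>i<m. \<forall>j<n. \<forall>x. A i j = Some x \<longrightarrow> x \<in> carrier G)"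

definition filled_cells :: "nat \<Rightarrow> nat \<Rightarrow> 'a pf_array \<Rightarrow> (nat \<times> nat) set" where
  "filled_cells m n A = {(i, j). i < m \<and> j < n \<and> A i j \<noteq> None}"

definition entries :: "nat \<Rightarrow> nat \<Rightarrow> 'a pf_array \<Rightarrow> 'a multiset" where
  "entries m n A = image_mset (\<lambda>(i, j). the (A i j)) (mset_set (filled_cells m n A))"

definition ordered_sum :: "('a, 'b) monoid_scheme \<Rightarrow> 'a list \<Rightarrow> 'a" where
  "ordered_sum G xs = foldr (\<lambda>x y. x \<otimes>\<^bsub>G\<^esub> y) xs \<one>\<^bsub>G\<^esub>"

text \<open>
  Empty cells are skipped, and the order of summation is fixed (left to right, respectively
  top to bottom) so that the definitions are also correct for non-abelian groups.
\<close>

definition row_sum :: "('a, 'b) monoid_scheme \<Rightarrow> nat \<Rightarrow> 'a pf_array \<Rightarrow> nat \<Rightarrow> 'a" where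
  "row_sum G n A i = ordered_sum G (List.map_filter (\<lambda>j. A i j) [0..<n])"

definition column_sum :: "('a, 'b) monoid_scheme \<Rightarrow> nat \<Rightarrow> 'a pf_array \<Rightarrow> nat \<Rightarrow> 'a" where
  "column_sum G m A j = ordered_sum G (List.map_filter (\<lambda>i. A i j) [0..<m])"

text \<open>
  \<open>is_NH lam t m n h k G J A\<close>: the array \<open>A\<close> is a
  ${}^\lambda\mathrm{NH}_t(m,n;h,k)$ over \<open>G\<close> relative to the subgroup \<open>J\<close> of order \<open>t\<close>.
\<close>

definition is_NH ::
  "nat \<Rightarrow> nat \<Rightarrow> nat \<Rightarrow> nat \<Rightarrow> nat \<Rightarrow> nat \<Rightarrow> ('a, 'b) monoid_scheme \<Rightarrow> 'a set \<Rightarrow> 'a pf_array \<Rightarrow> bool"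
where
  "is_NH lam t m n h k G J A \<longleftrightarrow>
     group G \<and> subgroup J G \<and> finite J \<and> card J = t \<and>
     pf_array_over G m n A \<and>
     (\<forall>i<m. card {j. j < n \<and> A i j \<noteq> None} = h) \<and>
     (\<forall>j<n. card {i. i < m \<and> A i j \<noteq> None} = k) \<and>
     (\<forall>x. count (entries m n A + image_mset (\<lambda>y. inv\<^bsub>G\<^esub> y) (entries m n A)) x =
            (if x \<in> carrier G - J then lam else 0)) \<and>
     (\<forall>i<m. row_sum G n A i \<noteq> \<one>\<^bsub>G\<^esub>) \<and>
     (\<forall>j<n. column_sum G m A j \<noteq> \<one>\<^bsub>G\<^esub>)"

definition is_square_NH ::
  "nat \<Rightarrow> nat \<Rightarrow> nat \<Rightarrow> nat \<Rightarrow> ('a, 'b) monoid_scheme \<Rightarrow> 'a set \<Rightarrow> 'a pf_array \<Rightarrow> bool"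
where
  "is_square_NH lam t n k G J A \<longleftrightarrow> is_NH lam t n n k k G J A"

end

theory Submission
  imports Defs "HOL-Algebra.Multiplicative_Group"
begin

text \<open>
  Split \<open>G - J\<close> into \<open>H\<close> and its inverses and write \<open>lam\<close> copies of \<open>H\<close> in any order into \<open>k\<close>
  consecutive cyclic diagonals; replacing entries by their inverses does not affect condition (b).
  For \<open>k \<ge> 2\<close> the first two diagonals form a single cycle through all rows and columns, so it
  remains to choose signs along a cycle such that no vertex has sum zero, the other signs being
  fixed. Given one edge at a vertex, at most one sign of the other edge is bad, hence a greedy choice
  around the cycle can only fail at the vertex where it closes up. It does not fail there if some
  initial value at that vertex is compatible with both signs of the last edge. If no vertex has such
  a value, then all fixed contributions vanish and all edge values agree up to sign, and giving them
  all the same value \<open>x\<close> makes every sum \<open>2 x\<close>, which is nonzero as the order of \<open>G\<close> is odd.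
\<close>

section \<open>Choosing signs around a cycle\<close>

text \<open>Cutting the cycle just before \<open>Suc r mod L\<close> leaves a path: the greedy
  choice starts there with \<open>b\<close> and ends at \<open>r\<close>, where the closing
  constraint holds whichever value was reached.\<close>

lemma cyclic_choice:
  fixes L r :: nat and S :: "nat \<Rightarrow> 'a set"
  assumes r: "r < L" and b: "b \<in> S (Suc r mod L)" "\<And>a. a \<in> S r \<Longrightarrow> R r a b"
    and step: "\<And>i a. i < L \<Longrightarrow> a \<in> S i \<Longrightarrow> \<exists>b\<in>S (Suc i mod L). R i a b"
  shows "\<exists>y. \<forall>i<L. y i \<in> S i \<and> R i (y i) (y (Suc i mod L))"
proof -
  define ix where "ix j = (Suc r + j) mod L" for j
  have ix: "ix j < L" "ix (Suc j) = Suc (ix j) mod L" for j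
    using r by (auto simp: ix_def mod_Suc_eq)
  \<comment> \<open>The walk is infinite and need not be periodic; only its first \<open>L\<close>
    values are used below.\<close>
  have "\<exists>w. \<forall>j. (w j \<in> S (ix j) \<and> (j = 0 \<longrightarrow> w j = b)) \<and> R (ix j) (w j) (w (Suc j))"
  proof (rule dependent_nat_choice)
    show "\<exists>x. x \<in> S (ix 0) \<and> (0 = (0::nat) \<longrightarrow> x = b)"
      using b by (auto simp: ix_def)
    fix x j assume "x \<in> S (ix j) \<and> (j = 0 \<longrightarrow> x = b)"
    then show "\<exists>y. (y \<in> S (ix (Suc j)) \<and> (Suc j = 0 \<longrightarrow> y = b)) \<and> R (ix j) x y"
      using step[of "ix j" x] ix by auto
  qed
  then obtain w where w: "\<And>j. w j \<in> S (ix j)" "w 0 = b" "\<And>j. R (ix j) (w j) (w (Suc j))"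
    by blast
  \<comment> \<open>\<open>m i\<close> is the position below \<open>L\<close> at which
    \<open>ix\<close> visits \<open>i\<close>; in particular \<open>r\<close> comes last.\<close>
  define m where "m i = (i + (L - Suc r)) mod L" for i
  have ixm: "ix (m i) = i" if "i < L" for i
  proof -
    have "ix (m i) = (Suc r + (i + (L - Suc r))) mod L"
      unfolding ix_def m_def by (rule mod_add_right_eq)
    also have "Suc r + (i + (L - Suc r)) = i + L"
      using r by simp
    finally show ?thesis using that by simp
  qed
  have msuc: "m (Suc i mod L) = Suc (m i) mod L" for i
    unfolding m_def by (simp add: mod_Suc_eq mod_add_left_eq)
  show ?thesis
  proof (intro exI[of _ "\<lambda>i. w (m i)"] allI impI conjI)
    fix i assume i: "i < L"
    show "w (m i) \<in> S i"
      using w(1)[of "m i"] ixm[OF i] by simp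
    show "R i (w (m i)) (w (m (Suc i mod L)))"
    proof (cases "Suc (m i) = L")
      case True
      then have "m i = L - 1" by simp
      then have "i = (Suc r + (L - 1)) mod L"
        using ixm[OF i] by (simp add: ix_def)
      also have "\<dots> = r"
        using r by simp
      finally have "i = r" .
      then show ?thesis
        using True w ixm[OF i] b msuc by (metis mod_self)
    next
      case False
      moreover have "m i < L" using r by (simp add: m_def)
      ultimately have "m (Suc i mod L) = Suc (m i)"
        using msuc by simp
      then show ?thesis using w(3)[of "m i"] ixm[OF i] by simp
    qed
  qed
qed

text \<open>With order \<open>2 * m + 1\<close>, the power of \<open>x\<close> to the order is
  \<open>x\<close> times a power of its square, hence \<open>x\<close>; by Lagrange it is also the
  unit.\<close>

lemma (in group) odd_order_square_eq_one:
  assumes "odd (order G)" "x \<in> carrier G" "x \<otimes> x = \<one>"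
  shows "x = \<one>"
proof -
  obtain m where m: "order G = Suc (2 * m)"
    using assms(1) by (auto elim: oddE)
  have "x [^] (2 * m) = (x [^] (2::nat)) [^] m"
    using assms(2) by (simp add: nat_pow_pow)
  also have "x [^] (2::nat) = \<one>"
    using assms by (simp add: numeral_2_eq_2)
  finally have "x [^] order G = x"
    using assms(2) by (simp add: m)
  then show ?thesis
    using pow_order_eq_1[OF assms(2)] by simp
qed

text \<open>Here \<open>y i\<close> is the signed value of edge \<open>i\<close>, and
  \<open>c i\<close> is the fixed contribution at the vertex between edges \<open>i\<close> and
  \<open>Suc i mod L\<close>.\<close>

lemma (in comm_group) cyclic_signs:
  fixes L :: nat
  assumes sq: "\<And>x. x \<in> carrier G \<Longrightarrow> x \<otimes> x = \<one> \<Longrightarrow> x = \<one>"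
    and L: "L > 0"
    and x: "\<And>i. i < L \<Longrightarrow> x i \<in> carrier G - {\<one>}"
    and c: "\<And>i. i < L \<Longrightarrow> c i \<in> carrier G"
  shows "\<exists>y. \<forall>i<L. y i \<in> {x i, inv x i} \<and> c i \<otimes> (y i \<otimes> y (Suc i mod L)) \<noteq> \<one>"
proof -
  define S where "S i = {x i, inv x i}" for i
  define R where "R i a b \<longleftrightarrow> c i \<otimes> (a \<otimes> b) \<noteq> \<one>" for i a b
  have xc: "x i \<in> carrier G" if "i < L" for i
    using x that by auto
  have S: "a \<in> carrier G" if "i < L" "a \<in> S i" for i a
    using xc that by (auto simp: S_def)
  have xinv: "x i \<noteq> inv x i" if "i < L" for i
    using sq[of "x i"] x[OF that] r_inv[of "x i"] by force
  have sucL: "Suc i mod L < L" for i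
    using L by simp
  have step: "\<exists>b\<in>S (Suc i mod L). R i a b" if i: "i < L" "a \<in> S i" for i a
  proof (rule ccontr)
    assume "\<not> ?thesis"
    then have "c i \<otimes> (a \<otimes> x (Suc i mod L)) = \<one>" "c i \<otimes> (a \<otimes> inv x (Suc i mod L)) = \<one>"
      by (auto simp: S_def R_def)
    then have "c i \<otimes> (a \<otimes> x (Suc i mod L)) = c i \<otimes> (a \<otimes> inv x (Suc i mod L))"
      by simp
    then have "x (Suc i mod L) = inv x (Suc i mod L)"
      using c[OF i(1)] S[OF i] xc[OF sucL[of i]] by simp
    then show False using xinv[OF sucL] by blast
  qed
  show ?thesis
  proof (cases "\<exists>r<L. \<exists>b\<in>S (Suc r mod L). \<forall>a\<in>S r. R r a b")
    case True
    then obtain r b where "r < L" "b \<in> S (Suc r mod L)" "\<And>a. a \<in> S r \<Longrightarrow> R r a b"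
      by blast
    from cyclic_choice[where R = R and S = S, OF this step]
    show ?thesis unfolding S_def R_def by blast
  next
    case False
    \<comment> \<open>Each sign of edge \<open>Suc i mod L\<close> is now blocked by some sign of
      edge \<open>i\<close>. By cancellation the two blocking signs differ, so they are inverse to
      each other.\<close>
    have key: "c i = \<one> \<and> x (Suc i mod L) \<in> {x i, inv x i}" if i: "i < L" for i
    proof -
      let ?z = "x (Suc i mod L)"
      have zc: "?z \<in> carrier G" using xc sucL by blast
      have bad: "\<exists>a\<in>S i. c i \<otimes> (a \<otimes> b) = \<one>" if "b \<in> S (Suc i mod L)" for b
        using False i that unfolding R_def by blast
      have "?z \<in> S (Suc i mod L)" "inv ?z \<in> S (Suc i mod L)"
        by (simp_all add: S_def)
      then obtain a a' where a: "a \<in> S i" "c i \<otimes> (a \<otimes> ?z) = \<one>"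
        and a': "a' \<in> S i" "c i \<otimes> (a' \<otimes> inv ?z) = \<one>"
        using bad by metis
      have ac: "a \<in> carrier G" "a' \<in> carrier G" "c i \<in> carrier G"
        using S[OF i] a a' c[OF i] by auto
      have "a \<noteq> a'"
      proof
        assume "a = a'"
        then have "c i \<otimes> (a \<otimes> ?z) = c i \<otimes> (a \<otimes> inv ?z)"
          using a a' by simp
        then have "?z = inv ?z"
          using ac zc by simp
        then show False using xinv[OF sucL] by blast
      qed
      then have aa: "a' = inv a"
        using a a' xc[OF i] by (auto simp: S_def)
      \<comment> \<open>The two blocked pairs make \<open>c i\<close> equal to both the inverse of
        \<open>a \<otimes> ?z\<close> and \<open>a \<otimes> ?z\<close> itself, so its square is the
        unit.\<close>
      have "inv (a \<otimes> ?z) = c i"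
        using a(2) ac zc by (intro inv_equality) auto
      have "inv (inv (a \<otimes> ?z)) = c i"
        using a'(2) ac zc unfolding aa by (intro inv_equality) (auto simp: inv_mult)
      then have "c i \<otimes> c i = \<one>"
        using a(2) ac zc by simp
      then have c1: "c i = \<one>" using sq ac by blast
      then have "?z \<otimes> a = \<one>" using a ac zc by (simp add: m_comm)
      then have "?z = inv a"
        using ac zc by (simp add: inv_equality)
      then show ?thesis using c1 a xc[OF i] by (auto simp: S_def)
    qed
    have same: "x 0 \<in> {x i, inv x i}" if "i < L" for i
      using that
    proof (induction i)
      case (Suc i)
      then have "x (Suc i) \<in> {x i, inv x i}" "x 0 \<in> {x i, inv x i}"
        using key[of i] by auto
      then show ?case using xc[of i] Suc.prems by auto
    qed simp
    have "x 0 \<otimes> x 0 \<noteq> \<one>"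
      using x[OF L] sq by blast
    then show ?thesis
      using same key xc[OF L] by (intro exI[of _ "\<lambda>_. x 0"]) auto
  qed
qed

section \<open>Signing the cells of a square array\<close>

text \<open>Serves to separate the two cells on the cycle from the fixed rest of a row or
  column.\<close>

lemma (in comm_group) finprod_split2:
  assumes "finite A" "a \<in> A" "b \<in> A" "a \<noteq> b" "f \<in> A \<rightarrow> carrier G"
  shows "finprod G f A = finprod G f (A - {a, b}) \<otimes> (f a \<otimes> f b)"
proof -
  have "A = insert a (insert b (A - {a, b}))"
    using assms by auto
  then have "finprod G f A = finprod G f (insert a (insert b (A - {a, b})))"
    by simp
  also have "\<dots> = f a \<otimes> (f b \<otimes> finprod G f (A - {a, b}))"
    using assms by (subst finprod_insert; (subst finprod_insert)?) (auto simp: Pi_def)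
  also have "\<dots> = finprod G f (A - {a, b}) \<otimes> (f a \<otimes> f b)"
  proof -
    have "f a \<in> carrier G" "f b \<in> carrier G" "finprod G f (A - {a, b}) \<in> carrier G"
      using assms by (auto simp: Pi_def)
    then show ?thesis by (simp add: m_ac)
  qed
  finally show ?thesis .
qed

text \<open>An instance of \<open>cyclic_signs\<close> with the \<open>2 * n\<close> rows and
  columns as vertices and the cells in \<open>diag\<close> as edges. All other cells keep
  \<open>f\<close> and form the fixed contributions. By \<open>2 \<le> n\<close> the two edges at a
  vertex are distinct cells.\<close>

lemma (in comm_group) nonzero_signing:
  fixes n :: nat
  assumes sq: "\<And>x. x \<in> carrier G \<Longrightarrow> x \<otimes> x = \<one> \<Longrightarrow> x = \<one>"
    and n: "2 \<le> n" and F: "F \<subseteq> {..<n} \<times> {..<n}"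
    and diag: "\<And>i. i < n \<Longrightarrow> (i, i) \<in> F" "\<And>i. i < n \<Longrightarrow> (i, Suc i mod n) \<in> F"
    and f: "\<And>p. p \<in> F \<Longrightarrow> f p \<in> carrier G - {\<one>}"
  shows "\<exists>g. (\<forall>p\<in>F. g p \<in> {f p, inv f p}) \<and>
    (\<forall>i<n. finprod G (\<lambda>j. g (i, j)) {j. (i, j) \<in> F} \<noteq> \<one>) \<and>
    (\<forall>j<n. finprod G (\<lambda>i. g (i, j)) {i. (i, j) \<in> F} \<noteq> \<one>)"
proof -
  \<comment> \<open>In the cycle, row \<open>i\<close> lies between edges \<open>2 i\<close> and \<open>2 i + 1\<close>, column \<open>i + 1\<close> between \<open>2 i + 1\<close> and \<open>2 i + 2\<close>.\<close>
  define e where "e m = (m div 2, (if even m then m div 2 else Suc (m div 2) mod n))" for m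
  \<comment> \<open>Product of the off-cycle cells in the row (even \<open>m\<close>) or column (odd
    \<open>m\<close>) where edge \<open>m\<close> meets the next edge.\<close>
  define c where "c m =
    (if even m
     then finprod G (\<lambda>j. f (m div 2, j)) ({j. (m div 2, j) \<in> F} - {m div 2, Suc (m div 2) mod n})
     else finprod G (\<lambda>i. f (i, Suc (m div 2) mod n))
            ({i. (i, Suc (m div 2) mod n) \<in> F} - {m div 2, Suc (m div 2) mod n}))" for m
  have e: "e m \<in> F" if "m < 2 * n" for m
    using that diag[of "m div 2"] by (auto simp: e_def)
  have fc: "f p \<in> carrier G" if "p \<in> F" for p
    using f[OF that] by simp
  have cc: "c m \<in> carrier G" for m
    unfolding c_def by (auto intro!: finprod_closed fc)
  have "\<exists>y. \<forall>m<2 * n. y m \<in> {f (e m), inv f (e m)} \<and>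
          c m \<otimes> (y m \<otimes> y (Suc m mod (2 * n))) \<noteq> \<one>"
    by (rule cyclic_signs[OF sq]) (use n f e cc in auto)
  then obtain y where y: "\<And>m. m < 2 * n \<Longrightarrow> y m \<in> {f (e m), inv f (e m)}"
    and ny: "\<And>m. m < 2 * n \<Longrightarrow> c m \<otimes> (y m \<otimes> y (Suc m mod (2 * n))) \<noteq> \<one>"
    by blast
  define g where "g p = (if snd p = fst p then y (2 * fst p)
     else if snd p = Suc (fst p) mod n then y (Suc (2 * fst p)) else f p)" for p
  have ne: "Suc i mod n \<noteq> i" if "i < n" for i
    using that n by (cases "Suc i = n") auto
  have g: "g p \<in> {f p, inv f p}" if p: "p \<in> F" for p
  proof -
    obtain i j where ij: "p = (i, j)" "i < n" "j < n"
      using p F by (cases p) auto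
    have "e (2 * i) = (i, i)" "e (Suc (2 * i)) = (i, Suc i mod n)"
      by (auto simp: e_def)
    then show ?thesis
      using ij y[of "2 * i"] y[of "Suc (2 * i)"] by (auto simp: g_def)
  qed
  have gc: "g p \<in> carrier G" if "p \<in> F" for p
    using g[OF that] fc[OF that] by auto
  have finr: "finite {j. (i, j) \<in> F}" for i
    by (rule finite_subset[of _ "{..<n}"]) (use F in auto)
  have finc: "finite {i. (i, j) \<in> F}" for j
    by (rule finite_subset[of _ "{..<n}"]) (use F in auto)
  have row: "finprod G (\<lambda>j. g (i, j)) {j. (i, j) \<in> F} \<noteq> \<one>" if i: "i < n" for i
  proof -
    let ?A = "{j. (i, j) \<in> F}" and ?s = "Suc i mod n"
    have "finprod G (\<lambda>j. g (i, j)) ?A =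
        finprod G (\<lambda>j. g (i, j)) (?A - {i, ?s}) \<otimes> (g (i, i) \<otimes> g (i, ?s))"
      using i finr diag ne[OF i] gc by (intro finprod_split2) auto
    also have "finprod G (\<lambda>j. g (i, j)) (?A - {i, ?s}) = c (2 * i)"
    proof -
      have "g (i, j) = f (i, j)" if "j \<in> ?A - {i, ?s}" for j
        using that by (auto simp: g_def)
      then show ?thesis
        unfolding c_def by (auto intro!: finprod_cong' fc)
    qed
    also have "g (i, i) = y (2 * i)" by (simp add: g_def)
    also have "g (i, ?s) = y (Suc (2 * i) mod (2 * n))"
      using ne[OF i] i by (simp add: g_def)
    finally show ?thesis using ny[of "2 * i"] i by simp
  qed
  have col: "finprod G (\<lambda>i. g (i, j)) {i. (i, j) \<in> F} \<noteq> \<one>" if j: "j < n" for j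
  proof -
    \<comment> \<open>The cyclic predecessor of \<open>j\<close>: the cycle meets column
      \<open>j\<close> in rows \<open>i\<close> and \<open>j\<close>. Its uniqueness,
      \<open>inj\<close>, ensures that the remaining cells of the column keep
      \<open>f\<close>.\<close>
    define i where "i = (if j = 0 then n - 1 else j - 1)"
    have i: "i < n" "j = Suc i mod n" using j n by (auto simp: i_def)
    have inj: "i' = i" if "i' < n" "j = Suc i' mod n" for i'
      using that i by (cases "Suc i' = n"; cases "Suc i = n") auto
    let ?A = "{i. (i, j) \<in> F}"
    have "finprod G (\<lambda>i. g (i, j)) ?A =
        finprod G (\<lambda>i. g (i, j)) (?A - {i, j}) \<otimes> (g (i, j) \<otimes> g (j, j))"
      using i j finc diag ne[OF i(1)] gc by (intro finprod_split2) auto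
    also have "finprod G (\<lambda>i. g (i, j)) (?A - {i, j}) = c (Suc (2 * i))"
    proof -
      have "g (i', j) = f (i', j)" if "i' \<in> ?A - {i, j}" for i'
        using that F inj[of i'] by (auto simp: g_def)
      then show ?thesis
        unfolding c_def using i by (auto intro!: finprod_cong' fc)
    qed
    also have "g (i, j) = y (Suc (2 * i))"
      using i ne[OF i(1)] by (simp add: g_def)
    \<comment> \<open>For \<open>j = 0\<close> the edge number \<open>2 * n\<close> wraps around to
      \<open>0\<close>.\<close>
    also have "g (j, j) = y (Suc (Suc (2 * i)) mod (2 * n))"
    proof -
      have "Suc (Suc (2 * i)) mod (2 * n) = (2 * Suc i) mod (2 * n)" by simp
      also have "\<dots> = 2 * j" unfolding i(2) by (rule mult_mod_right[symmetric])
      finally show ?thesis by (simp add: g_def)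
    qed
    finally show ?thesis using ny[of "Suc (2 * i)"] i by simp
  qed
  show ?thesis using g row col by blast
qed

section \<open>Cyclic diagonals\<close>

text \<open>Turns reductions modulo \<open>n\<close> into case distinctions that linear arithmetic
  can settle.\<close>

lemma mod_lt_double:
  fixes x n :: nat
  assumes "x < 2 * n"
  shows "x mod n = (if x < n then x else x - n)"
  using assms by (simp add: le_mod_geq)

text \<open>\<open>(j + n - i) mod n\<close> numbers the diagonal through a cell, with
  \<open>0\<close> for the main one; adding \<open>n\<close> first keeps the subtraction from
  truncating.\<close>

definition cyclic_diagonals :: "nat \<Rightarrow> nat \<Rightarrow> (nat \<times> nat) set" where
  "cyclic_diagonals n k = {(i, j). i < n \<and> j < n \<and> (j + n - i) mod n < k}"

text \<open>Within a row, the column and the diagonal number determine each other.\<close>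

lemma cyclic_diagonals_row:
  assumes "k \<le> n" "i < n"
  shows "card {j. (i, j) \<in> cyclic_diagonals n k} = k"
proof -
  have "bij_betw (\<lambda>d. (i + d) mod n) {..<k} {j. (i, j) \<in> cyclic_diagonals n k}"
    by (rule bij_betw_byWitness[where f' = "\<lambda>j. (j + n - i) mod n"])
      (use assms in \<open>auto simp: cyclic_diagonals_def mod_lt_double\<close>)
  from bij_betw_same_card[OF this] show ?thesis by simp
qed

lemma cyclic_diagonals_column:
  assumes "k \<le> n" "j < n"
  shows "card {i. (i, j) \<in> cyclic_diagonals n k} = k"
proof -
  have "bij_betw (\<lambda>d. (j + n - d) mod n) {..<k} {i. (i, j) \<in> cyclic_diagonals n k}"
    by (rule bij_betw_byWitness[where f' = "\<lambda>i. (j + n - i) mod n"])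
      (use assms in \<open>auto simp: cyclic_diagonals_def mod_lt_double\<close>)
  from bij_betw_same_card[OF this] show ?thesis by simp
qed

lemma card_cyclic_diagonals:
  assumes "k \<le> n"
  shows "card (cyclic_diagonals n k) = n * k"
proof -
  have "cyclic_diagonals n k = Sigma {..<n} (\<lambda>i. {j. (i, j) \<in> cyclic_diagonals n k})"
    by (auto simp: cyclic_diagonals_def)
  moreover have "finite {j. (i, j) \<in> cyclic_diagonals n k}" for i
    by (rule finite_subset[of _ "{..<n}"]) (auto simp: cyclic_diagonals_def)
  ultimately have "card (cyclic_diagonals n k) =
      (\<Sum>i<n. card {j. (i, j) \<in> cyclic_diagonals n k})"
    using card_SigmaI[OF finite_lessThan, of n "\<lambda>i. {j. (i, j) \<in> cyclic_diagonals n k}"] by simp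
  then show ?thesis using cyclic_diagonals_row[OF assms] by simp
qed

section \<open>Ordered sums and multisets of entries\<close>

text \<open>Commutativity removes the order of summation, which links the row and column sums of the
  array to the products in \<open>nonzero_signing\<close>.\<close>

lemma (in comm_group) ordered_sum_map_filter:
  assumes "distinct js" "\<And>j x. j \<in> set js \<Longrightarrow> h j = Some x \<Longrightarrow> x \<in> carrier G"
  shows "ordered_sum G (List.map_filter h js) =
    finprod G (\<lambda>j. the (h j)) {j \<in> set js. h j \<noteq> None}"
  using assms
proof (induction js)
  case Nil
  then show ?case by (simp add: ordered_sum_def List.map_filter_def)
next
  case (Cons a js)
  have IH: "ordered_sum G (List.map_filter h js) =
      finprod G (\<lambda>j. the (h j)) {j \<in> set js. h j \<noteq> None}"
    using Cons.prems by (intro Cons.IH) auto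
  show ?case
  proof (cases "h a")
    case None
    then have "{j \<in> set (a # js). h j \<noteq> None} = {j \<in> set js. h j \<noteq> None}"
      by auto
    moreover have "List.map_filter h (a # js) = List.map_filter h js"
      using None by (simp add: List.map_filter_def)
    ultimately show ?thesis using IH by simp
  next
    case (Some x)
    then have "{j \<in> set (a # js). h j \<noteq> None} = insert a {j \<in> set js. h j \<noteq> None}"
      by auto
    moreover have "finprod G (\<lambda>j. the (h j)) (insert a {j \<in> set js. h j \<noteq> None}) =
        the (h a) \<otimes> finprod G (\<lambda>j. the (h j)) {j \<in> set js. h j \<noteq> None}"
      using Cons.prems(1) Cons.prems(2) Some by (intro finprod_insert) (auto intro: Cons.prems(2))
    ultimately show ?thesis
      using IH Some by (simp add: List.map_filter_def ordered_sum_def)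
  qed
qed

text \<open>Groups the entries and their inverses cell by cell, so that a change of sign only swaps
  the members of a pair.\<close>

lemma image_mset_plus_image_mset:
  "image_mset h M + image_mset h' M = (\<Sum>p\<in>#M. {#h p, h' p#})"
  by (induction M) auto

lemma image_mset_repeat_mset:
  "image_mset h (repeat_mset l M) = repeat_mset l (image_mset h M)"
  by (induction l) auto

text \<open>Tags below \<open>l\<close> keep the copies of an element apart, so that an ordinary
  bijection of sets can distribute them over cells.\<close>

lemma image_fst_mset_set_Times:
  assumes "finite H"
  shows "image_mset fst (mset_set (H \<times> {..<l::nat})) = repeat_mset l (mset_set H)"
proof (rule multiset_eqI)
  fix y
  let ?X = "H \<times> {..<l}"
  have fin: "finite ?X" using assms by simp
  have "count (image_mset fst (mset_set ?X)) y = (\<Sum>p | p \<in> ?X \<and> y = fst p. count (mset_set ?X) p)"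
    using fin by (simp only: count_image_mset' finite_set_mset_mset_set)
  also have "\<dots> = (\<Sum>p | p \<in> ?X \<and> y = fst p. 1)"
    using fin by (intro sum.cong) auto
  also have "\<dots> = card {p. p \<in> ?X \<and> y = fst p}"
    by simp
  also have "{p. p \<in> ?X \<and> y = fst p} = (if y \<in> H then {y} \<times> {..<l} else {})"
    by auto
  also have "card \<dots> = count (repeat_mset l (mset_set H)) y"
    using assms by (simp add: card_cartesian_product)
  finally show "count (image_mset fst (mset_set ?X)) y = count (repeat_mset l (mset_set H)) y" .
qed

section \<open>Halving an inverse-closed set\<close>

text \<open>An injective numbering of \<open>S\<close> selects from each two-element set of mutual
  inverses the one with the smaller number.\<close>

lemma (in group) half_set:
  assumes fin: "finite S" and S: "S \<subseteq> carrier G"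
    and closed: "\<And>x. x \<in> S \<Longrightarrow> inv x \<in> S" and fixfree: "\<And>x. x \<in> S \<Longrightarrow> inv x \<noteq> x"
  obtains H where "S = H \<union> m_inv G ` H" "H \<inter> m_inv G ` H = {}" "card S = 2 * card H"
proof -
  obtain h :: "'a \<Rightarrow> nat" where h: "inj_on h S"
    using finite_imp_inj_to_nat_seg[OF fin] by blast
  define H where "H = {x \<in> S. h x < h (inv x)}"
  have ii: "inv (inv x) = x" if "x \<in> S" for x
    using S that by auto
  have un: "S = H \<union> m_inv G ` H"
  proof
    show "S \<subseteq> H \<union> m_inv G ` H"
    proof
      fix x assume x: "x \<in> S"
      have "h x \<noteq> h (inv x)"
        using inj_onD[OF h _ x closed[OF x]] fixfree[OF x] by auto
      then consider "h x < h (inv x)" | "h (inv x) < h x" by linarith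
      then show "x \<in> H \<union> m_inv G ` H"
      proof cases
        case 2
        then have "inv x \<in> H" using x closed ii by (simp add: H_def)
        then show ?thesis using ii[OF x] by (metis UnI2 image_eqI)
      qed (use x in \<open>simp add: H_def\<close>)
    qed
  qed (use closed in \<open>auto simp: H_def\<close>)
  have disj: "H \<inter> m_inv G ` H = {}"
    using ii by (auto simp: H_def)
  have "inj_on (m_inv G) H"
    by (rule inj_on_inverseI[where g = "m_inv G"]) (simp add: H_def ii)
  moreover have "finite H" using fin by (simp add: H_def)
  ultimately have "card (H \<union> m_inv G ` H) = 2 * card H"
    using disj by (simp add: card_Un_disjoint card_image)
  then have "card S = 2 * card H"
    unfolding un[symmetric] .
  with un disj show ?thesis by (rule that)
qed

section \<open>Assembling the array\<close>

theorem theorem3p4: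
  fixes G :: "('a, 'b) monoid_scheme" and J :: "'a set"
    and v t lam n k :: nat
  assumes "comm_group G" and "finite (carrier G)" and "order G = v" and "odd v"
    and "subgroup J G" and "card J = t"
    and "lam > 0" and "n > 0" and "k > 0"
    and "n \<ge> k"
    and "real v = 2 * real n * real k / real lam + real t"
    and "t dvd v"
  shows "\<exists>A. is_square_NH lam t n k G J A"
proof -
  interpret comm_group G by fact
  interpret J: subgroup J G by fact
  have sq: "x = \<one>\<^bsub>G\<^esub>" if "x \<in> carrier G" "x \<otimes>\<^bsub>G\<^esub> x = \<one>\<^bsub>G\<^esub>" for x
    using odd_order_square_eq_one that assms(3,4) by blast
  have finJ: "finite J" using assms(2) J.subset finite_subset by blast
  let ?S = "carrier G - J"
  obtain H where H: "?S = H \<union> m_inv G ` H" "H \<inter> m_inv G ` H = {}" "card ?S = 2 * card H"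
  proof (rule half_set[of ?S])
    fix x assume x: "x \<in> ?S"
    \<comment> \<open>If the inverse of \<open>x\<close> were in \<open>J\<close>, then so would be
      \<open>x\<close>.\<close>
    show "inv\<^bsub>G\<^esub> x \<in> ?S" using x J.m_inv_closed[of "inv\<^bsub>G\<^esub> x"] by auto
    show "inv\<^bsub>G\<^esub> x \<noteq> x"
      using x sq[of x] J.one_closed by (metis DiffE r_inv)
  qed (use assms(2) in auto)
  have HS: "H \<subseteq> ?S" using H(1) by blast
  have finH: "finite H" using HS assms(2) finite_subset by blast
  define F where "F = cyclic_diagonals n k"
  have F: "F \<subseteq> {..<n} \<times> {..<n}" by (auto simp: F_def cyclic_diagonals_def)
  then have finF: "finite F" by (rule finite_subset) simp
  \<comment> \<open>Since \<open>v - t\<close> counts \<open>?S\<close>, which is twice as large as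
    \<open>H\<close>, the order equation says \<open>card H * lam = n * k\<close>.\<close>
  have "card F = card (H \<times> {..<lam})"
  proof -
    have "v = card ?S + t"
      using assms(2,3,6) finJ J.subset card_mono[OF assms(2) J.subset]
      by (simp add: card_Diff_subset order_def)
    then have "real (2 * card H) = 2 * real n * real k / real lam"
      using assms(11) H(3) by simp
    then have "real (card H * lam) = real (n * k)"
      using assms(7) by (simp add: field_simps)
    then show ?thesis
      using assms(10) unfolding of_nat_eq_iff
      by (simp add: F_def card_cyclic_diagonals card_cartesian_product)
  qed
  then obtain \<phi> where \<phi>: "bij_betw \<phi> F (H \<times> {..<lam})"
    using finite_same_card_bij[OF finF finite_cartesian_product[OF finH finite_lessThan]] by metis
  define f where "f p = fst (\<phi> p)" for p
  have f: "f p \<in> H" if "p \<in> F" for p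
    using bij_betwE[OF \<phi>] that by (auto simp: f_def mem_Times_iff)
  have HG: "x \<in> carrier G - {\<one>\<^bsub>G\<^esub>}" if "x \<in> H" for x
    using HS J.one_closed that by auto
  have "\<exists>g. (\<forall>p\<in>F. g p \<in> {f p, inv\<^bsub>G\<^esub> f p}) \<and>
    (\<forall>i<n. finprod G (\<lambda>j. g (i, j)) {j. (i, j) \<in> F} \<noteq> \<one>\<^bsub>G\<^esub>) \<and>
    (\<forall>j<n. finprod G (\<lambda>i. g (i, j)) {i. (i, j) \<in> F} \<noteq> \<one>\<^bsub>G\<^esub>)"
  proof (cases "k = 1")
    \<comment> \<open>A single diagonal carries no cycle, but each row and column sum is then one
      entry from \<open>H\<close>, hence not the unit.\<close>
    case True
    have diag: "(i, i) \<in> F" if "i < n" for i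
      using that True by (simp add: F_def cyclic_diagonals_def)
    have single: "{j. (i, j) \<in> F} = {i}" "{j. (j, i) \<in> F} = {i}" if "i < n" for i
    proof -
      have "card {j. (i, j) \<in> F} = 1" "card {j. (j, i) \<in> F} = 1"
        using cyclic_diagonals_row cyclic_diagonals_column assms(10) that True by (simp_all add: F_def)
      then obtain a b where ab: "{j. (i, j) \<in> F} = {a}" "{j. (j, i) \<in> F} = {b}"
        by (elim card_1_singletonE)
      have "i \<in> {j. (i, j) \<in> F}" "i \<in> {j. (j, i) \<in> F}"
        using diag[OF that] by simp_all
      then show "{j. (i, j) \<in> F} = {i}" "{j. (j, i) \<in> F} = {i}"
        unfolding ab by simp_all
    qed
    have "f (i, i) \<in> carrier G - {\<one>\<^bsub>G\<^esub>}" if "i < n" for i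
      by (rule HG[OF f[OF diag[OF that]]])
    then show ?thesis
      using single by (intro exI[of _ f]) simp
  next
    case False
    then have "2 \<le> k" using assms(9) by simp
    show ?thesis
    proof (rule nonzero_signing[OF sq])
      fix i assume i: "i < n"
      show "(i, i) \<in> F"
        using i \<open>2 \<le> k\<close> by (simp add: F_def cyclic_diagonals_def)
      show "(i, Suc i mod n) \<in> F"
        using i \<open>2 \<le> k\<close> by (auto simp: F_def cyclic_diagonals_def mod_lt_double)
    qed (use assms(10) \<open>2 \<le> k\<close> F f HG in auto)
  qed
  then obtain g where g: "\<And>p. p \<in> F \<Longrightarrow> g p \<in> {f p, inv\<^bsub>G\<^esub> f p}"
    and row: "\<And>i. i < n \<Longrightarrow> finprod G (\<lambda>j. g (i, j)) {j. (i, j) \<in> F} \<noteq> \<one>\<^bsub>G\<^esub>"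
    and col: "\<And>j. j < n \<Longrightarrow> finprod G (\<lambda>i. g (i, j)) {i. (i, j) \<in> F} \<noteq> \<one>\<^bsub>G\<^esub>"
    by blast
  have gc: "g p \<in> carrier G" if "p \<in> F" for p
    using g[OF that] HG[OF f[OF that]] by auto
  define A where "A i j = (if (i, j) \<in> F then Some (g (i, j)) else None)" for i j
  have cells: "filled_cells n n A = F"
    using F by (auto simp: filled_cells_def A_def)
  have rowA: "row_sum G n A i \<noteq> \<one>\<^bsub>G\<^esub>" if "i < n" for i
  proof -
    have "row_sum G n A i = finprod G (\<lambda>j. the (A i j)) {j \<in> set [0..<n]. A i j \<noteq> None}"
      unfolding row_sum_def
      by (rule ordered_sum_map_filter) (auto simp: A_def gc split: if_splits)
    also have "{j \<in> set [0..<n]. A i j \<noteq> None} = {j. (i, j) \<in> F}"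
      using F by (auto simp: A_def)
    also have "finprod G (\<lambda>j. the (A i j)) {j. (i, j) \<in> F} =
        finprod G (\<lambda>j. g (i, j)) {j. (i, j) \<in> F}"
      by (rule finprod_cong') (auto simp: A_def gc)
    finally show ?thesis using row[OF that] by simp
  qed
  have colA: "column_sum G n A j \<noteq> \<one>\<^bsub>G\<^esub>" if "j < n" for j
  proof -
    have "column_sum G n A j = finprod G (\<lambda>i. the (A i j)) {i \<in> set [0..<n]. A i j \<noteq> None}"
      unfolding column_sum_def
      by (rule ordered_sum_map_filter) (auto simp: A_def gc split: if_splits)
    also have "{i \<in> set [0..<n]. A i j \<noteq> None} = {i. (i, j) \<in> F}"
      using F by (auto simp: A_def)
    also have "finprod G (\<lambda>i. the (A i j)) {i. (i, j) \<in> F} =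
        finprod G (\<lambda>i. g (i, j)) {i. (i, j) \<in> F}"
      by (rule finprod_cong') (auto simp: A_def gc)
    finally show ?thesis using col[OF that] by simp
  qed
  have rows: "card {j. j < n \<and> A i j \<noteq> None} = k" if "i < n" for i
  proof -
    have "{j. j < n \<and> A i j \<noteq> None} = {j. (i, j) \<in> F}"
      using F by (auto simp: A_def)
    then show ?thesis using cyclic_diagonals_row[OF assms(10) that] by (simp add: F_def)
  qed
  have cols: "card {i. i < n \<and> A i j \<noteq> None} = k" if "j < n" for j
  proof -
    have "{i. i < n \<and> A i j \<noteq> None} = {i. (i, j) \<in> F}"
      using F by (auto simp: A_def)
    then show ?thesis using cyclic_diagonals_column[OF assms(10) that] by (simp add: F_def)
  qed
  have count: "count (entries n n A + image_mset (m_inv G) (entries n n A)) x =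
      (if x \<in> ?S then lam else 0)" for x
  proof -
    let ?M = "mset_set F"
    have "entries n n A = image_mset g ?M"
      unfolding entries_def cells
      by (rule image_mset_cong) (use finF in \<open>auto simp: A_def\<close>)
    then have "entries n n A + image_mset (m_inv G) (entries n n A) =
        image_mset g ?M + image_mset (\<lambda>p. inv\<^bsub>G\<^esub> g p) ?M"
      by (simp add: multiset.map_comp comp_def)
    also have "\<dots> = (\<Sum>p\<in>#?M. {#g p, inv\<^bsub>G\<^esub> g p#})"
      by (rule image_mset_plus_image_mset)
    \<comment> \<open>The signing \<open>g\<close> can be replaced by \<open>f\<close> here, as
      either sign gives the same pair.\<close>
    also have "\<dots> = (\<Sum>p\<in>#?M. {#f p, inv\<^bsub>G\<^esub> f p#})"
    proof (intro arg_cong[where f = sum_mset] image_mset_cong)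
      fix p assume "p \<in># ?M"
      then have p: "p \<in> F" using finF by simp
      then have "inv\<^bsub>G\<^esub> (inv\<^bsub>G\<^esub> f p) = f p"
        using HG[OF f] by simp
      then show "{#g p, inv\<^bsub>G\<^esub> g p#} = {#f p, inv\<^bsub>G\<^esub> f p#}"
        using g[OF p] by (auto simp: add_mset_commute)
    qed
    also have "\<dots> = image_mset f ?M + image_mset (\<lambda>p. inv\<^bsub>G\<^esub> f p) ?M"
      by (rule image_mset_plus_image_mset[symmetric])
    also have "\<dots> = image_mset f ?M + image_mset (m_inv G) (image_mset f ?M)"
      by (simp add: multiset.map_comp comp_def)
    also have "image_mset f ?M = image_mset fst (mset_set (H \<times> {..<lam}))"
    proof -
      have "f = fst \<circ> \<phi>"
        by (auto simp: f_def)
      then have "image_mset f ?M = image_mset fst (image_mset \<phi> ?M)"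
        by (simp add: multiset.map_comp)
      also have "image_mset \<phi> ?M = mset_set (\<phi> ` F)"
        by (rule image_mset_mset_set[OF bij_betw_imp_inj_on[OF \<phi>]])
      finally show ?thesis
        by (simp only: bij_betw_imp_surj_on[OF \<phi>])
    qed
    also have "\<dots> = repeat_mset lam (mset_set H)"
      by (rule image_fst_mset_set_Times[OF finH])
    also have "image_mset (m_inv G) (repeat_mset lam (mset_set H)) =
        repeat_mset lam (image_mset (m_inv G) (mset_set H))"
      by (rule image_mset_repeat_mset)
    also have "image_mset (m_inv G) (mset_set H) = mset_set (m_inv G ` H)"
      using HG by (intro image_mset_mset_set inj_on_subset[OF inv_inj]) auto
    \<comment> \<open>\<open>H\<close> and its inverses partition \<open>?S\<close>, so their
      multisets add up to that of \<open>?S\<close>.\<close>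
    also have "repeat_mset lam (mset_set H) + repeat_mset lam (mset_set (m_inv G ` H)) =
        repeat_mset lam (mset_set ?S)"
      unfolding H(1) using finH H(2) by (simp only: mset_set_Union finite_imageI repeat_mset_distrib2)
    finally show ?thesis
      using assms(2) by (simp add: count_mset_set')
  qed
  have "pf_array_over G n n A"
    by (auto simp: pf_array_over_def A_def gc)
  then have "is_square_NH lam t n k G J A"
    unfolding is_square_NH_def is_NH_def
    using rows cols count rowA colA finJ assms(5,6) is_group by simp
  then show ?thesis by blast
qed

end
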